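(* Let $\mathcal{V}$ be a finite vocabulary, let $L\ge 1$ and $1\le N\le L$, and let $\mathcal{Y}=\mathcal{V}^L$. Let $p$ be the distribution on $\mathcal{Y}$ with $p(y_i\mid y_{[i-1]})=\frac{1}{|\mathcal{V}|}$ for all $y\in\mathcal{Y}$ and all $i\in\{1,\dots,L\}$. Suppose that each query to the next-token predictor takes time $C$. Then any optimal deterministic or optimal stochastic decoding algorithm $\mathcal{D}$ for the $N$-gram Hamming loss, when run with next-token predictor $p$, must have a running time of at least $C(|\mathcal{V}|^L-1)$ (for a stochastic decoder: almost surely over its internal randomness).
   Context: For a sequence $y=y_1\cdots y_L$, $y_{[i]}=y_1\cdots y_i$ (with $y_{[0]}$ empty) and $y_{i:j}=y_iy_{i+1}\cdots y_j$. The $N$-gram Hamming loss between $\hat y,y\in\mathcal{Y}$ is $\sum_{i=1}^{L-N+1}\mathbf{1}\{\hat y_{i:i+N-1}\neq y_{i:i+N-1}\}$. A next-token predictor is a family of conditional probability distributions $q(\cdot\mid y_{[i-1]})$ on $\mathcal{V}$, one for every prefix $y_{[i-1]}\in\mathcal{V}^{i-1}$, $1\le i\le L$; it determines a distribution $q(y)=\prod_{i=1}^L q(y_i\mid y_{[i-1]})$ on $\mathcal{V}^L$. A decoding algorithm has access to $q$ only through queries, chosen adaptively: a query specifies a prefix $y_{[i-1]}$ and a token $v\in\mathcal{V}$ and returns the single number $q(v\mid y_{[i-1]})$. After finitely many queries the algorithm outputs a sequence $\hat y\in\mathcal{V}^L$. It is deterministic if it uses no internal randomness, and stochastic otherwise.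 The running time is at least $C$ times the number of distinct queries made. A deterministic decoder is optimal for the $N$-gram Hamming loss if, for every next-token predictor $q$, its output $\hat y$ minimizes $\mathbb{E}_{y\sim q}\big[\sum_{i=1}^{L-N+1}\mathbf{1}\{\hat y_{i:i+N-1}\neq y_{i:i+N-1}\}\big]$ over $\mathcal{V}^L$. A stochastic decoder is called optimal if, for every $q$, it outputs such a minimizer with probability one. *)

theory Defs
  imports "HOL-Probability.Probability"
begin

text \<open>
  The vocabulary is a finite type, and \<open>q x\<close> is the conditional distribution of the
  token following the prefix \<open>x\<close>.  For sequences of length \<open>L\<close> only the prefixes of length
  less than \<open>L\<close> matter; values of \<open>q\<close> at longer lists influence neither the
  sequence distribution nor an admissible decoder.
\<close>

type_synonym 'v predictor = "'v list \<Rightarrow> 'v pmf"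

primrec seq_pmf :: "'v predictor \<Rightarrow> nat \<Rightarrow> 'v list pmf" where
  "seq_pmf q 0 = return_pmf []"
| "seq_pmf q (Suc n) = bind_pmf (seq_pmf q n) (\<lambda>y. map_pmf (\<lambda>v. y @ [v]) (q y))"

text \<open>
  Here \<open>seq_pmf q L\<close> is the distribution on sequences of length \<open>L\<close> given by the product of the
  conditional probabilities:
\<close>

lemma pmf_seq_pmf:
  "pmf (seq_pmf q L) y =
     (if length y = L then \<Prod>i<L. pmf (q (take i y)) (y ! i) else 0)"
proof (induction L arbitrary: y)
  case 0
  show ?case by (simp add: pmf_return)
next
  case (Suc n)
  show ?case
  proof (cases y rule: rev_cases)
    case Nil
    then show ?thesis
      by (auto simp: pmf_eq_0_set_pmf)
  next
    case (snoc x v)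
    have *: "pmf (map_pmf (\<lambda>v. z @ [v]) (q z)) (x @ [v]) = indicator {x} z * pmf (q x) v" for z
    proof (cases "z = x")
      case True
      then show ?thesis
        using pmf_map_inj'[of "\<lambda>v. x @ [v]" "q x" v] by (simp add: inj_def)
    next
      case False
      then show ?thesis by (auto simp: pmf_eq_0_set_pmf)
    qed
    have "pmf (seq_pmf q (Suc n)) y = pmf (seq_pmf q n) x * pmf (q x) v"
      by (simp add: snoc pmf_bind * measure_pmf_single)
    then show ?thesis
      by (simp add: snoc Suc.IH nth_append)
  qed
qed

definition ngram_loss :: "nat \<Rightarrow> nat \<Rightarrow> 'v list \<Rightarrow> 'v list \<Rightarrow> real" where
  "ngram_loss L N z y =
     (\<Sum>i<L - N + 1. of_bool (take N (drop i z) \<noteq> take N (drop i y)))"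

definition ngram_risk :: "nat \<Rightarrow> nat \<Rightarrow> 'v predictor \<Rightarrow> 'v list \<Rightarrow> real" where
  "ngram_risk L N q z = measure_pmf.expectation (seq_pmf q L) (ngram_loss L N z)"

definition loss_minimizer :: "nat \<Rightarrow> nat \<Rightarrow> 'v predictor \<Rightarrow> 'v list \<Rightarrow> bool" where
  "loss_minimizer L N q z \<longleftrightarrow> is_arg_min (ngram_risk L N q) (\<lambda>y. length y = L) z"

text \<open>
  A deterministic adaptive query procedure is a decision tree: \<open>Query x v k\<close> asks for the
  probability of token \<open>v\<close> after prefix \<open>x\<close> and continues with \<open>k\<close> applied to the answer.
  Since a datatype has only well-founded values, every run stops after finitely many
  queries, but there need not be a common bound on their number.
\<close>

datatype 'v decoder =
  Output "'v list"
| Query "'v list" 'v "real \<Rightarrow> 'v decoder"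

primrec decoded :: "'v predictor \<Rightarrow> 'v decoder \<Rightarrow> 'v list" where
  "decoded q (Output y) = y"
| "decoded q (Query x v k) = decoded q (k (pmf (q x) v))"

text \<open>Being a set, \<open>queries q D\<close> counts a repeated query only once.\<close>

primrec queries :: "'v predictor \<Rightarrow> 'v decoder \<Rightarrow> ('v list \<times> 'v) set" where
  "queries q (Output y) = {}"
| "queries q (Query x v k) = insert (x, v) (queries q (k (pmf (q x) v)))"

lemma finite_queries: "finite (queries q D)"
  by (induction D) auto

definition admissible :: "nat \<Rightarrow> 'v decoder \<Rightarrow> bool" where
  "admissible L D \<longleftrightarrow>
     (\<forall>q. (\<forall>(x, v) \<in> queries q D. length x < L) \<and> length (decoded q D) = L)"

definition optimal_deterministic :: "nat \<Rightarrow> nat \<Rightarrow> 'v decoder \<Rightarrow> bool" where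
  "optimal_deterministic L N D \<longleftrightarrow>
     admissible L D \<and> (\<forall>q. loss_minimizer L N q (decoded q D))"

text \<open>
  A stochastic decoder is a deterministic one selected by a random seed \<open>\<omega>\<close> drawn from a
  probability space \<open>M\<close>; the seed carries all random choices made during the run.
  Note that the exceptional null set in the optimality condition may depend on \<open>q\<close>.
\<close>

definition optimal_stochastic ::
    "nat \<Rightarrow> nat \<Rightarrow> 'w measure \<Rightarrow> ('w \<Rightarrow> 'v decoder) \<Rightarrow> bool" where
  "optimal_stochastic L N M D \<longleftrightarrow>
     prob_space M \<and> (\<forall>\<omega>\<in>space M. admissible L (D \<omega>)) \<and>
     (\<forall>q. AE \<omega> in M. loss_minimizer L N q (decoded q (D \<omega>)))"

end

theory Submission
  imports Defs
begin

text \<open>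
  A prefix \<open>x\<close> of length \<open>m < L\<close> at which two tokens \<open>v \<noteq> w\<close> are left unqueried allows the
  adversary to move all the mass of \<open>w\<close> at \<open>x\<close> onto \<open>v\<close>, or the other way round, without the
  decoder noticing.  Under the first modification every minimizer carries \<open>v\<close> at position
  \<open>m\<close>, under the second one \<open>w\<close>, and no single output does both.  So at least
  \<open>CARD('v) - 1\<close> queries are made at each of the
  \<open>\<Sum>i<L. CARD('v) ^ i\<close> prefixes of length less than \<open>L\<close>.
\<close>

section \<open>The adversary's predictors and what a run can see of them\<close>

definition move_mass :: "'v predictor \<Rightarrow> 'v list \<Rightarrow> 'v \<Rightarrow> 'v \<Rightarrow> 'v predictor" where
  "move_mass p x v w = p(x := map_pmf (\<lambda>u. if u = w then v else u) (p x))"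

lemma pmf_map_merge:
  assumes "v \<noteq> w"
  shows "pmf (map_pmf (\<lambda>u. if u = w then v else u) P) a =
    (if a = v then pmf P v + pmf P w else if a = w then 0 else pmf P a)"
proof -
  have "(\<lambda>u. if u = w then v else u) -` {a} = (if a = v then {v, w} else if a = w then {} else {a})"
    using assms by (auto split: if_splits)
  then show ?thesis
    using assms by (simp add: pmf_map measure_pmf_single measure_measure_pmf_finite)
qed

text \<open>Every query of the run on \<open>p\<close> gets the same answer from \<open>q\<close>,
  so both runs follow the same branch of the tree.\<close>

lemma decoded_cong:
  assumes "\<And>x v. (x, v) \<in> queries p D \<Longrightarrow> pmf (q x) v = pmf (p x) v"
  shows "decoded q D = decoded p D"
  using assms by (induction D) auto

section \<open>The N-gram loss as a count of windows without full agreement\<close>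

lemma take_drop_eq_iff:
  assumes "length z = L" "length y = L" "i + N \<le> L"
  shows "take N (drop i z) = take N (drop i y) \<longleftrightarrow> (\<forall>k\<in>{i..<i + N}. z ! k = y ! k)"
proof -
  have "take N (drop i z) = take N (drop i y) \<longleftrightarrow> (\<forall>j<N. z ! (i + j) = y ! (i + j))"
    using assms by (auto simp: list_eq_iff_nth_eq)
  also have "\<dots> \<longleftrightarrow> (\<forall>k\<in>{i..<i + N}. z ! k = y ! k)"
    by (auto simp: nat_le_iff_add)
  finally show ?thesis .
qed

text \<open>Absolute positions in place of sublists: the effect of changing single letters can then
  be followed window by window.\<close>

lemma ngram_loss_nth:
  assumes "length z = L" "length y = L" "N \<le> L"
  shows "ngram_loss L N z y =
    (\<Sum>i<L - N + 1. of_bool (\<not> (\<forall>k\<in>{i..<i + N}. z ! k = y ! k)))"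
  unfolding ngram_loss_def
proof (intro sum.cong refl)
  fix i assume "i \<in> {..<L - N + 1}"
  then have "i + N \<le> L" using assms(3) by auto
  then show "of_bool (take N (drop i z) \<noteq> take N (drop i y)) =
      (of_bool (\<not> (\<forall>k\<in>{i..<i + N}. z ! k = y ! k)) :: real)"
    using take_drop_eq_iff[OF assms(1,2)] by simp
qed

lemma ngram_loss_mono:
  assumes "length z = L" "length y = L" "length y' = L" "N \<le> L"
    and "\<And>i. \<forall>k\<in>{i..<i + N}. z ! k = y' ! k \<Longrightarrow> \<forall>k\<in>{i..<i + N}. z ! k = y ! k"
  shows "ngram_loss L N z y \<le> ngram_loss L N z y'"
  unfolding ngram_loss_nth[OF assms(1,2,4)] ngram_loss_nth[OF assms(1,3,4)]
  using assms(5) by (intro sum_mono) (simp only: of_bool_def split: if_split, force)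

lemma sum_ngram_loss_const:
  fixes z z' :: "'v :: finite list"
  assumes "length z = L" "length z' = L" "N \<le> L"
  shows "(\<Sum>y | length y = L. ngram_loss L N z y) = (\<Sum>y | length y = L. ngram_loss L N z' y)"
proof -
  \<comment> \<open>Swapping the letters of \<open>z\<close> and \<open>z'\<close> position by position carries \<open>z\<close> to \<open>z'\<close> and preserves the loss.\<close>
  define s where "s y = map (\<lambda>k. Transposition.transpose (z ! k) (z' ! k) (y ! k)) [0..<L]" for y
  have len: "length (s y) = L" for y by (simp add: s_def)
  have ss: "s (s y) = y" if "length y = L" for y
    using that by (auto simp: s_def list_eq_iff_nth_eq)
  have loss: "ngram_loss L N z' (s y) = ngram_loss L N z y" if "length y = L" for y
  proof -
    have nth: "z' ! k = s y ! k \<longleftrightarrow> z ! k = y ! k" if "k < L" for k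
      using that by (auto simp: s_def Transposition.transpose_def)
    have "(\<forall>k\<in>{i..<i + N}. z' ! k = s y ! k) \<longleftrightarrow> (\<forall>k\<in>{i..<i + N}. z ! k = y ! k)"
      if "i < L - N + 1" for i
      using that assms(3) by (intro ball_cong refl nth) auto
    then show ?thesis
      using assms that len by (simp add: ngram_loss_nth del: ball_simps)
  qed
  show ?thesis
    by (rule sum.reindex_bij_witness[where i = s and j = s]) (auto simp: len ss loss)
qed

section \<open>Risk and its minimizers after mass has been moved\<close>

lemma ngram_risk_eq_sum:
  fixes q :: "'v :: finite predictor"
  shows "ngram_risk L N q z = (\<Sum>y | length y = L. pmf (seq_pmf q L) y * ngram_loss L N z y)"
proof -
  have "finite {y :: 'v list. length y = L}"
    using finite_lists_length_eq[of "UNIV :: 'v set" L] by simp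
  moreover have "set_pmf (seq_pmf q L) \<subseteq> {y. length y = L}"
    by (auto simp: set_pmf_iff pmf_seq_pmf split: if_splits)
  ultimately show ?thesis
    unfolding ngram_risk_def
    by (subst integral_measure_pmf[where A = "{y. length y = L}"]) auto
qed

text \<open>Only the factor at position \<open>length x\<close> can differ from the uniform one: it
  doubles if \<open>y\<close> continues \<open>x\<close> with \<open>v\<close>, and vanishes if
  \<open>y\<close> continues \<open>x\<close> with \<open>w\<close>.\<close>

lemma pmf_seq_pmf_move_mass:
  fixes p :: "'v :: finite predictor"
  assumes unif: "\<And>x u. length x < L \<Longrightarrow> pmf (p x) u = 1 / real CARD('v)"
    and x: "length x < L" and vw: "v \<noteq> w" and y: "length y = L"
  shows "pmf (seq_pmf (move_mass p x v w) L) y = (1 / real CARD('v)) ^ L *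
    (1 + of_bool (take (length x) y = x \<and> y ! length x = v)
       - of_bool (take (length x) y = x \<and> y ! length x = w))"
proof -
  define m where "m = length x"
  let ?c = "1 / real CARD('v)"
  define e :: real where "e = 1 + of_bool (take m y = x \<and> y ! m = v) - of_bool (take m y = x \<and> y ! m = w)"
  have "pmf (move_mass p x v w (take i y)) (y ! i) = ?c * (if i = m then e else 1)" if "i < L" for i
  proof (cases "take i y = x")
    case True
    then have "i = m" using that y by (auto simp: m_def)
    with True show ?thesis
      using vw x by (auto simp: move_mass_def pmf_map_merge unif e_def)
  next
    case False
    then show ?thesis
      using that y by (auto simp: move_mass_def unif e_def)
  qed
  then have "pmf (seq_pmf (move_mass p x v w) L) y = (\<Prod>i<L. ?c * (if i = m then e else 1))"
    using y by (simp add: pmf_seq_pmf)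
  also have "\<dots> = ?c ^ L * (\<Prod>i<L. if i = m then e else 1)"
    by (simp only: prod.distrib prod_constant card_lessThan)
  also have "(\<Prod>i<L. if i = m then e else 1) = e"
    using x by (simp add: m_def prod.delta)
  finally show ?thesis by (simp add: e_def m_def)
qed

text \<open>Compared with the uniform distribution, each \<open>y\<close> through \<open>x\<close>
  followed by \<open>w\<close> hands its mass to \<open>y[length x := v]\<close>. The risk is thus
  the uniform one plus the resulting changes of loss.\<close>

lemma ngram_risk_move_mass:
  fixes p :: "'v :: finite predictor"
  assumes unif: "\<And>x u. length x < L \<Longrightarrow> pmf (p x) u = 1 / real CARD('v)"
    and x: "length x < L" and vw: "v \<noteq> w"
  shows "ngram_risk L N (move_mass p x v w) z = (1 / real CARD('v)) ^ L *
    ((\<Sum>y | length y = L. ngram_loss L N z y) +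
     (\<Sum>y | length y = L \<and> take (length x) y = x \<and> y ! length x = w.
        ngram_loss L N z (y[length x := v]) - ngram_loss L N z y))"
proof -
  define m where "m = length x"
  let ?A = "{y :: 'v list. length y = L}"
  let ?B = "\<lambda>u. {y :: 'v list. length y = L \<and> take m y = x \<and> y ! m = u}"
  let ?c = "(1 / real CARD('v)) ^ L"
  have fin: "finite ?A"
    using finite_lists_length_eq[of "UNIV :: 'v set" L] by simp
  have restrict: "(\<Sum>y\<in>?A. of_bool (take m y = x \<and> y ! m = u) * ngram_loss L N z y) =
      (\<Sum>y\<in>?B u. ngram_loss L N z y)" for u
    using fin by (intro sum.mono_neutral_cong_right) auto
  have "ngram_risk L N (move_mass p x v w) z =
      (\<Sum>y\<in>?A. ?c * (1 + of_bool (take m y = x \<and> y ! m = v)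
        - of_bool (take m y = x \<and> y ! m = w)) * ngram_loss L N z y)"
    unfolding ngram_risk_eq_sum m_def
    by (intro sum.cong refl) (simp add: pmf_seq_pmf_move_mass[OF unif x vw])
  also have "\<dots> = ?c * ((\<Sum>y\<in>?A. ngram_loss L N z y) +
      (\<Sum>y\<in>?A. of_bool (take m y = x \<and> y ! m = v) * ngram_loss L N z y) -
      (\<Sum>y\<in>?A. of_bool (take m y = x \<and> y ! m = w) * ngram_loss L N z y))"
    unfolding sum.distrib[symmetric] sum_subtractf[symmetric] sum_distrib_left
    by (intro sum.cong refl) (simp only: algebra_simps)
  also have "\<dots> = ?c * ((\<Sum>y\<in>?A. ngram_loss L N z y) +
      ((\<Sum>y\<in>?B v. ngram_loss L N z y) - (\<Sum>y\<in>?B w. ngram_loss L N z y)))"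
    by (simp only: restrict add_diff_eq)
  \<comment> \<open>Overwriting position \<open>m\<close> is a bijection between the sequences
    passing through \<open>x\<close> to \<open>v\<close> and those passing through \<open>x\<close>
    to \<open>w\<close>.\<close>
  also have "(\<Sum>y\<in>?B v. ngram_loss L N z y) = (\<Sum>y\<in>?B w. ngram_loss L N z (y[m := v]))"
    using x by (intro sum.reindex_bij_witness[where i = "\<lambda>y. y[m := v]" and j = "\<lambda>y. y[m := w]"])
      (auto simp: m_def)
  finally show ?thesis
    by (simp only: sum_subtractf m_def)
qed

text \<open>Up to a constant and a positive factor the risk is the sum \<open>h\<close> of loss
  changes when \<open>w\<close> becomes \<open>v\<close>. It is nonnegative for an output without
  \<open>v\<close> at this position and negative for an output that extends \<open>x\<close> by
  \<open>v\<close>.\<close>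

lemma loss_minimizer_move_mass_nth:
  fixes p :: "'v :: finite predictor"
  assumes unif: "\<And>x u. length x < L \<Longrightarrow> pmf (p x) u = 1 / real CARD('v)"
    and N: "1 \<le> N" "N \<le> L"
    and x: "length x < L" and vw: "v \<noteq> w"
    and min: "loss_minimizer L N (move_mass p x v w) z"
  shows "z ! length x = v"
proof (rule ccontr)
  define m where "m = length x"
  define B where "B = {y :: 'v list. length y = L \<and> take m y = x \<and> y ! m = w}"
  define h where "h z = (\<Sum>y\<in>B. ngram_loss L N z (y[m := v]) - ngram_loss L N z y)" for z
  \<comment> \<open>The competitor; its letters after position \<open>m\<close> are arbitrary
    padding.\<close>
  define z' where "z' = x @ v # replicate (L - m - 1) v"
  have finB: "finite B"
    by (rule finite_subset[OF _ finite_lists_length_eq[of "UNIV :: 'v set" L]]) (auto simp: B_def)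
  have m: "m < L" using x by (simp add: m_def)
  have lenz: "length z = L"
    using min by (simp add: loss_minimizer_def is_arg_min_def)
  have lenz': "length z' = L" using m by (simp add: z'_def m_def)
  have nthz': "z' ! m = v" by (simp add: z'_def m_def)
  have takez': "take m z' = x" by (simp add: z'_def m_def)
  have risk: "ngram_risk L N (move_mass p x v w) u =
      (1 / real CARD('v)) ^ L * ((\<Sum>y | length y = L. ngram_loss L N u y) + h u)" for u
    using ngram_risk_move_mass[OF unif x vw] by (simp only: h_def B_def m_def)
  assume "z ! length x \<noteq> v"
  then have zm: "z ! m \<noteq> v" by (simp add: m_def)
  \<comment> \<open>A window on which \<open>z\<close> agrees with \<open>y[m := v]\<close> avoids
    \<open>m\<close>, where \<open>z\<close> differs from \<open>v\<close>; off \<open>m\<close> the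
    update changes nothing.\<close>
  have le_z: "ngram_loss L N z y \<le> ngram_loss L N z (y[m := v])" if "y \<in> B" for y
  proof -
    have "(\<forall>k\<in>{i..<i + N}. z ! k = y ! k)"
      if "\<forall>k\<in>{i..<i + N}. z ! k = y[m := v] ! k" for i
    proof
      fix k assume k: "k \<in> {i..<i + N}"
      then have "z ! k = y[m := v] ! k" using that by blast
      moreover have "k \<noteq> m"
        using calculation zm m \<open>y \<in> B\<close> by (auto simp: B_def)
      ultimately show "z ! k = y ! k" by simp
    qed
    then show ?thesis
      using \<open>y \<in> B\<close> lenz N by (intro ngram_loss_mono) (auto simp: B_def)
  qed
  \<comment> \<open>Since \<open>z'\<close> has \<open>v\<close> and \<open>y\<close> has
    \<open>w\<close> at \<open>m\<close>, a window of agreement avoids \<open>m\<close> and survives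
    the update.\<close>
  have imp_z': "\<forall>k\<in>{i..<i + N}. z' ! k = y[m := v] ! k"
    if "y \<in> B" "\<forall>k\<in>{i..<i + N}. z' ! k = y ! k" for i y
    using that nthz' vw m by (auto simp: B_def nth_list_update dest!: bspec)
  have le_z': "ngram_loss L N z' (y[m := v]) \<le> ngram_loss L N z' y" if "y \<in> B" for y
    using that lenz' N by (intro ngram_loss_mono imp_z') (auto simp: B_def)
  \<comment> \<open>The strict case: restoring \<open>v\<close> in \<open>z'[m := w]\<close> gives
    back \<open>z'\<close>, whose loss against itself is 0.\<close>
  have less_z': "ngram_loss L N z' (z'[m := w, m := v]) < ngram_loss L N z' (z'[m := w])"
  proof -
    \<comment> \<open>The start of the last window that contains \<open>m\<close> and still fits
      into length \<open>L\<close>.\<close>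
    define i where "i = min m (L - N)"
    have i: "i < L - N + 1" "m \<in> {i..<i + N}"
      using N m by (auto simp: i_def)
    have "z'[m := w, m := v] = z'" using nthz' by (metis list_update_id list_update_overwrite)
    moreover have "ngram_loss L N z' z' = 0" by (simp add: ngram_loss_def)
    moreover have "0 < ngram_loss L N z' (z'[m := w])"
    proof -
      have "\<not> (\<forall>k\<in>{i..<i + N}. z' ! k = z'[m := w] ! k)"
        using i(2) nthz' vw m lenz' by (intro notI) (auto dest: bspec[where x = m])
      then show ?thesis
        using i(1) N lenz' unfolding ngram_loss_nth[OF lenz' trans[OF length_list_update lenz'] N(2)]
        by (intro sum_pos2[where i = i]) auto
    qed
    ultimately show ?thesis by simp
  qed
  have "h z' < (\<Sum>y\<in>B. 0)"
    unfolding h_def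
  proof (rule sum_strict_mono_ex1[OF finB])
    show "\<forall>y\<in>B. ngram_loss L N z' (y[m := v]) - ngram_loss L N z' y \<le> 0"
      using le_z' by simp
    have "z'[m := w] \<in> B" using lenz' takez' m by (simp add: B_def)
    with less_z' show "\<exists>y\<in>B. ngram_loss L N z' (y[m := v]) - ngram_loss L N z' y < 0"
      by (intro bexI[of _ "z'[m := w]"]) auto
  qed
  moreover have "0 \<le> h z"
    unfolding h_def using le_z by (intro sum_nonneg) simp
  ultimately have "h z' < h z" by simp
  \<comment> \<open>The sum of losses over all sequences is the same for \<open>z\<close> and
    \<open>z'\<close>, so \<open>h\<close> alone decides.\<close>
  then have "ngram_risk L N (move_mass p x v w) z' < ngram_risk L N (move_mass p x v w) z"
    unfolding risk sum_ngram_loss_const[OF lenz' lenz N(2)]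
    by (intro mult_strict_left_mono) auto
  with min lenz' show False
    by (auto simp: loss_minimizer_def is_arg_min_def)
qed

section \<open>Counting queries over all prefixes\<close>

lemma card_ge_if_two_missing_eq:
  fixes S :: "'a :: finite set"
  assumes "\<And>v w. v \<notin> S \<Longrightarrow> w \<notin> S \<Longrightarrow> v = w"
  shows "real CARD('a) - 1 \<le> real (card S)"
proof -
  have "card (- S) \<le> 1"
    using assms by (simp add: card_le_Suc0_iff_eq)
  moreover have "CARD('a) = card S + card (- S)"
    by (subst card_Un_disjoint[symmetric]) auto
  ultimately show ?thesis by simp
qed

text \<open>Each prefix of length below \<open>L\<close> contributes at least
  \<open>CARD('v) - 1\<close> pairs, and the geometric sum over the lengths telescopes.\<close>

lemma card_ge_if_two_missing_eq_at_prefixes: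
  fixes Q :: "('v :: finite list \<times> 'v) set"
  assumes "finite Q"
    and missing: "\<And>x v w. length x < L \<Longrightarrow> (x, v) \<notin> Q \<Longrightarrow> (x, w) \<notin> Q \<Longrightarrow> v = w"
  shows "real CARD('v) ^ L - 1 \<le> real (card Q)"
proof -
  let ?X = "\<Union>i<L. {x :: 'v list. length x = i}"
  have fin: "finite {x :: 'v list. length x = i}" for i
    using finite_lists_length_eq[of "UNIV :: 'v set" i] by simp
  have cardX: "card ?X = (\<Sum>i<L. CARD('v) ^ i)"
    using fin card_lists_length_eq[of "UNIV :: 'v set"]
    by (subst card_UN_disjoint) auto
  have "real CARD('v) ^ L - 1 = (\<Sum>x\<in>?X. real CARD('v) - 1)"
    by (simp add: cardX power_diff_1_eq mult.commute)
  also have "\<dots> \<le> (\<Sum>x\<in>?X. real (card {v. (x, v) \<in> Q}))"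
    using missing by (intro sum_mono card_ge_if_two_missing_eq) auto
  also have "\<dots> = real (card (SIGMA x:?X. {v. (x, v) \<in> Q}))"
    using fin by (subst card_SigmaI) auto
  also have "\<dots> \<le> real (card Q)"
    using assms(1) by (intro of_nat_mono card_mono) auto
  finally show ?thesis .
qed

text \<open>Minimality is assumed only at the predictors \<open>move_mass p x v w\<close>, a
  countable family; this lets the stochastic case use the same bound for almost every seed.\<close>

lemma card_queries_ge:
  fixes p :: "'v :: finite predictor"
  assumes unif: "\<And>x u. length x < L \<Longrightarrow> pmf (p x) u = 1 / real CARD('v)"
    and N: "1 \<le> N" "N \<le> L"
    and min: "\<And>x v w. loss_minimizer L N (move_mass p x v w) (decoded (move_mass p x v w) D)"
  shows "real CARD('v) ^ L - 1 \<le> real (card (queries p D))"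
proof (rule card_ge_if_two_missing_eq_at_prefixes[OF finite_queries])
  fix x v w
  assume x: "length x < L" and v: "(x, v) \<notin> queries p D" and w: "(x, w) \<notin> queries p D"
  have nth: "decoded p D ! length x = a"
    if "a \<noteq> b" "(x, a) \<notin> queries p D" "(x, b) \<notin> queries p D" for a b
  proof -
    have "decoded (move_mass p x a b) D = decoded p D"
      using that by (intro decoded_cong) (auto simp: move_mass_def pmf_map_merge)
    with min[of x a b] show ?thesis
      using loss_minimizer_move_mass_nth[OF unif N x that(1)] by simp
  qed
  \<comment> \<open>Otherwise the one output \<open>decoded p D\<close> would carry both
    \<open>v\<close> and \<open>w\<close> at position \<open>length x\<close>.\<close>
  show "v = w"
    using nth[of v w] nth[of w v] v w by metis
qed

theorem theorem4p2:
  fixes L N :: nat and C :: real and p :: "('v :: finite) predictor"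
  assumes "1 \<le> L" and "1 \<le> N" and "N \<le> L" and "0 \<le> C"
    and "\<And>y i. length y = L \<Longrightarrow> i < L \<Longrightarrow> pmf (p (take i y)) (y ! i) = 1 / real CARD('v)"
  shows "(\<forall>(D :: 'v decoder) (time :: 'v predictor \<Rightarrow> real).
            optimal_deterministic L N D \<longrightarrow>
            (\<forall>q. C * real (card (queries q D)) \<le> time q) \<longrightarrow>
            C * (real CARD('v) ^ L - 1) \<le> time p) \<and>
         (\<forall>(M :: 'w measure) (D :: 'w \<Rightarrow> 'v decoder) (time :: 'w \<Rightarrow> 'v predictor \<Rightarrow> real).
            optimal_stochastic L N M D \<longrightarrow>
            (\<forall>\<omega>\<in>space M. \<forall>q. C * real (card (queries q (D \<omega>))) \<le> time \<omega> q) \<longrightarrow>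
            (AE \<omega> in M. C * (real CARD('v) ^ L - 1) \<le> time \<omega> p))"
proof -
  \<comment> \<open>The hypothesis concerns sequences of length \<open>L\<close>, so
    \<open>x\<close> followed by \<open>u\<close> is padded to that length.\<close>
  have unif: "pmf (p x) u = 1 / real CARD('v)" if "length x < L" for x u
    using assms(5)[of "x @ u # replicate (L - length x - 1) u" "length x"] that by simp
  have time: "C * (real CARD('v) ^ L - 1) \<le> t"
    if "\<forall>x v w. loss_minimizer L N (move_mass p x v w) (decoded (move_mass p x v w) D)"
      and "C * real (card (queries p D)) \<le> t" for D t
  proof -
    have "real CARD('v) ^ L - 1 \<le> real (card (queries p D))"
      using that(1) by (intro card_queries_ge[OF unif assms(2,3)]) auto
    from mult_left_mono[OF this \<open>0 \<le> C\<close>] that(2) show ?thesis by linarith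
  qed
  show ?thesis
  proof (intro conjI allI impI)
    fix D :: "'v decoder" and t :: "'v predictor \<Rightarrow> real"
    assume "optimal_deterministic L N D" "\<forall>q. C * real (card (queries q D)) \<le> t q"
    then show "C * (real CARD('v) ^ L - 1) \<le> t p"
      by (intro time) (auto simp: optimal_deterministic_def)
  next
    fix M :: "'w measure" and D :: "'w \<Rightarrow> 'v decoder" and t :: "'w \<Rightarrow> 'v predictor \<Rightarrow> real"
    assume opt: "optimal_stochastic L N M D"
      and t: "\<forall>\<omega>\<in>space M. \<forall>q. C * real (card (queries q (D \<omega>))) \<le> t \<omega> q"
    \<comment> \<open>The null set may depend on the predictor, but only countably many triples
      \<open>x\<close>, \<open>v\<close>, \<open>w\<close> occur, so the quantifiers move
      inside.\<close>
    have "AE \<omega> in M. \<forall>x v w.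
        loss_minimizer L N (move_mass p x v w) (decoded (move_mass p x v w) (D \<omega>))"
      using opt unfolding optimal_stochastic_def AE_all_countable by blast
    with AE_space show "AE \<omega> in M. C * (real CARD('v) ^ L - 1) \<le> t \<omega> p"
    proof eventually_elim
      case (elim \<omega>)
      then show ?case using t by (intro time) auto
    qed
  qed
qed

end
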